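(* The following hold. (i) Conditions (RS1) and (RS2) are not sufficient for Devaney chaos: there exist $C^1$ functions $f_1,f_2:\mathbb{R}^2\to\mathbb{R}^2$, a $T$-invariant set $D$ of solutions of $\dot x\in\{f_1(x),f_2(x)\}$, and a nonempty set $V\subseteq\mathbb{R}^2$ such that (RS1) and (RS2) hold for $V$ and $D$, but $T|_{V^*}$ does not exhibit Devaney chaos, where $V^*=\{x\in D : x(t)\in V \text{ for all } t\in\mathbb{R}\}$. (ii) Condition (RS1) is not sufficient for $\omega$-chaos: there exist $C^1$ functions $f_1,f_2:\mathbb{R}^2\to\mathbb{R}^2$, a $T$-invariant set $D$ of solutions of $\dot x\in\{f_1(x),f_2(x)\}$, and a nonempty set $V\subseteq\mathbb{R}^2$ such that (RS1) holds for $V$ and $D$, but $(D,T)$ is not $\omega$-chaotic. (iii) Condition (RS1) is not sufficient for infinite topological entropy: there exist $C^1$ functions $f_1,f_2:\mathbb{R}^2\to\mathbb{R}^2$, a $T$-invariant set $D$ of solutions of $\dot x\in\{f_1(x),f_2(x)\}$, and a nonempty set $V\subseteq\mathbb{R}^2$ such that (RS1) holds for $V$ and $D$, but the topological entropy $h_{top}(T)$ of $T$ on $D$ is not infinite.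
   Context: Solutions. Given $C^1$ functions $f_1,f_2:\mathbb{R}^2\to\mathbb{R}^2$, a solution of $\dot x\in\{f_1(x),f_2(x)\}$ is an absolutely continuous function $x:\mathbb{R}\to\mathbb{R}^2$ with $\dot x(t)\in\{f_1(x(t)),f_2(x(t))\}$ for almost every $t$. $D$ denotes a set of such solutions (not necessarily all of them) that is invariant under time shifts, and $T:D\times\mathbb{R}\to D$ is the natural $\mathbb{R}$-action $T(x,t)=T_t(x)=y$, $y(s)=x(t+s)$ for all $s\in\mathbb{R}$. "$T$-invariant" means invariant under all $T_t$, $t\in\mathbb{R}$. Metric. $D$ carries the metric $\nu(x,y)=\sup_{t\in\mathbb{R}} \nu_t(x,y)/2^{|t|}$, where $\nu_t(x,y)=\min\{d(x(t),y(t)),1\}$ and $d$ is the usual metric on $\mathbb{R}^2$. Simple paths. For $a,b\in\mathbb{R}^2$, there is a path from $a$ to $b$ generated by $D$ if there are $v\in D$ and $t_0<t_1$ in $\mathbb{R}$ with $v(t_0)=a$, $v(t_1)=b$. It is a simple path if moreover $\dot v$ has finitely many discontinuities on $[t_0,t_1]$ and $v(t)\neq a$, $v(t)\neq b$ for all $t_0<t<t_1$. The path is the set $\{v(t):t_0\le t\le t_1\}$, oriented by increasing time; it is in $V$ if this set is contained in $V$. (RS1) For every $a,b\in V$ there is a simple path from $a$ to $b$ in $V$ generated by $D$. (RS2) There is a solution $w\in D$ such that $w(t)\in V$ for all $t\in\mathbb{R}$ and $\{w(t):t\in\mathbb{R}\}$ is not dense in $V$. Devaney chaos. Let $R\subseteq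 D$ be closed and $T$-invariant. $(R,T)$ (or $T|_R$) has Devaney chaos if on $R$ the action $T$ is topologically transitive, has a dense set of periodic points, and has sensitive dependence on initial conditions, i.e. there is $\delta>0$ such that for every $x\in R$ and $\epsilon>0$ there are $z\in R$ with $\nu(x,z)<\epsilon$ and $s\in\mathbb{R}$ with $\nu(T_s(x),T_s(z))>\delta$. $\omega$-chaos. For $x\in D$ let $\omega(x)$ be the omega-limit set of $x$ under $T$. A set $S\subseteq D$ with at least two points is an $\omega$-scrambled set if for any $x,y\in S$ with $x\ne y$: $\omega(x)\setminus\omega(y)$ is uncountable; $\omega(x)\cap\omega(y)\neq\emptyset$; and $\omega(x)$ is not included in the set of periodic points. $(D,T)$ is $\omega$-chaotic if there is an uncountable $\omega$-scrambled set in $D$. Topological entropy. For $s>0$ let $\nu_s^T(x,y)=\max_{-s\le t\le s}\nu(T_t(x),T_t(y))$ and $B_T(x,\epsilon,s)=\{y\in D:\nu_s^T(x,y)<\epsilon\}$. A set $E\subseteq D$ is $(s,\epsilon)$-spanning if $D\subseteq\bigcup_{x\in E}B_T(x,\epsilon,s)$; $S_\nu(T,\epsilon,s)$ is the minimal cardinality of an $(s,\epsilon)$-spanning set, and $h_{top}(T)=\lim_{\epsilon\to0}\limsup_{s\to\infty}\frac1s\log S_\nu(T,\epsilon,s)$. *)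

theory Defs
  imports "HOL-Analysis.Analysis"
begin

section \<open>Solutions of the differential inclusion\<close>

type_synonym plane = "real ^ 2"

definition C1_field :: "(plane \<Rightarrow> plane) \<Rightarrow> bool" where
  "C1_field f \<longleftrightarrow>
     (\<exists>f' :: plane \<Rightarrow> (plane \<Rightarrow>\<^sub>L plane).
        (\<forall>x. (f has_derivative blinfun_apply (f' x)) (at x)) \<and> continuous_on UNIV f')"

text \<open>
  A finite family of non-overlapping compact subintervals of \<open>S\<close> is rendered as a division \<open>d\<close>
  of its union \<open>t\<close>; a member \<open>k\<close> of \<open>d\<close> is the interval from \<open>Inf k\<close> to \<open>Sup k\<close>.
\<close>
definition absolutely_continuous_on :: "real set \<Rightarrow> (real \<Rightarrow> 'a::real_normed_vector) \<Rightarrow> bool" where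
  "absolutely_continuous_on S g \<longleftrightarrow>
     (\<forall>\<epsilon>>0. \<exists>\<delta>>0. \<forall>d t. d division_of t \<longrightarrow> t \<subseteq> S \<longrightarrow> (\<Sum>k\<in>d. Sup k - Inf k) < \<delta> \<longrightarrow>
        (\<Sum>k\<in>d. norm (g (Sup k) - g (Inf k))) < \<epsilon>)"

text \<open>
  As usual for solutions on an unbounded interval, absolute continuity of \<open>x\<close> on the real line
  means absolute continuity on every compact interval.
\<close>
definition is_solution :: "(plane \<Rightarrow> plane) \<Rightarrow> (plane \<Rightarrow> plane) \<Rightarrow> (real \<Rightarrow> plane) \<Rightarrow> bool" where
  "is_solution f\<^sub>1 f\<^sub>2 x \<longleftrightarrow>
     (\<forall>a b. absolutely_continuous_on {a..b} x) \<and>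
     (AE t in lebesgue. \<exists>d \<in> {f\<^sub>1 (x t), f\<^sub>2 (x t)}. (x has_vector_derivative d) (at t))"

definition shift :: "real \<Rightarrow> (real \<Rightarrow> plane) \<Rightarrow> real \<Rightarrow> plane" where
  "shift t x = (\<lambda>s. x (t + s))"

definition shift_invariant :: "(real \<Rightarrow> plane) set \<Rightarrow> bool" where
  "shift_invariant R \<longleftrightarrow> (\<forall>t. shift t ` R \<subseteq> R)"

section \<open>The metric\<close>

definition nu_at :: "real \<Rightarrow> (real \<Rightarrow> plane) \<Rightarrow> (real \<Rightarrow> plane) \<Rightarrow> real" where
  "nu_at t x y = min (dist (x t) (y t)) 1"

definition nu :: "(real \<Rightarrow> plane) \<Rightarrow> (real \<Rightarrow> plane) \<Rightarrow> real" where
  "nu x y = (SUP t. nu_at t x y / 2 powr \<bar>t\<bar>)"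

lemma nu_term_bounds: "0 \<le> nu_at t x y / 2 powr \<bar>t\<bar>" "nu_at t x y / 2 powr \<bar>t\<bar> \<le> 1"
proof -
  show "0 \<le> nu_at t x y / 2 powr \<bar>t\<bar>"
    by (simp add: nu_at_def)
  have "nu_at t x y \<le> 1" by (simp add: nu_at_def)
  moreover have "(1::real) \<le> 2 powr \<bar>t\<bar>" by (simp add: ge_one_powr_ge_zero)
  ultimately show "nu_at t x y / 2 powr \<bar>t\<bar> \<le> 1"
    by (simp add: divide_le_eq)
qed

lemma bdd_above_nu: "bdd_above (range (\<lambda>t. nu_at t x y / 2 powr \<bar>t\<bar>))"
  by (rule bdd_aboveI[of _ 1]) (use nu_term_bounds(2) in blast)

lemma nu_upper: "nu_at t x y / 2 powr \<bar>t\<bar> \<le> nu x y"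
  unfolding nu_def by (rule cSUP_upper[OF UNIV_I bdd_above_nu])

lemma nu_least: "(\<And>t. nu_at t x y / 2 powr \<bar>t\<bar> \<le> c) \<Longrightarrow> nu x y \<le> c"
  unfolding nu_def by (rule cSUP_least) auto

lemma nu_nonneg: "0 \<le> nu x y"
  using nu_upper[of 0 x y] nu_term_bounds(1)[of 0 x y] by linarith

lemma nu_le_1: "nu x y \<le> 1"
  by (rule nu_least) (rule nu_term_bounds)

lemma Metric_space_nu: "Metric_space D nu"
proof
  show "0 \<le> nu x y" for x y by (rule nu_nonneg)
  show "nu x y = nu y x" for x y by (simp add: nu_def nu_at_def dist_commute)
  show "nu x y = 0 \<longleftrightarrow> x = y" for x y
  proof
    assume nu0: "nu x y = 0"
    show "x = y"
    proof
      fix t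
      have "nu_at t x y / 2 powr \<bar>t\<bar> = 0"
        using nu_upper[of t x y] nu_term_bounds(1)[of t x y] nu0 by linarith
      then show "x t = y t" by (auto simp: nu_at_def min_def split: if_splits)
    qed
  next
    assume "x = y"
    then show "nu x y = 0" by (simp add: nu_def nu_at_def)
  qed
  show "nu x z \<le> nu x y + nu y z" for x y z
  proof (rule nu_least)
    fix t
    have "nu_at t x z \<le> nu_at t x y + nu_at t y z"
      using dist_triangle[of "x t" "z t" "y t"] zero_le_dist[of "x t" "y t"] zero_le_dist[of "y t" "z t"]
      unfolding nu_at_def by linarith
    then have "nu_at t x z / 2 powr \<bar>t\<bar> \<le> nu_at t x y / 2 powr \<bar>t\<bar> + nu_at t y z / 2 powr \<bar>t\<bar>"
      by (simp add: add_divide_distrib[symmetric] divide_right_mono)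
    also have "\<dots> \<le> nu x y + nu y z"
      by (intro add_mono nu_upper)
    finally show "nu_at t x z / 2 powr \<bar>t\<bar> \<le> nu x y + nu y z" .
  qed
qed

text \<open>The topology induced by the metric \<open>nu\<close> on a set \<open>R\<close> of solutions.\<close>
definition nu_topology :: "(real \<Rightarrow> plane) set \<Rightarrow> (real \<Rightarrow> plane) topology" where
  "nu_topology R = Metric_space.mtopology R nu"

section \<open>Simple paths and the conditions (RS1) and (RS2)\<close>

text \<open>
  That the derivative of \<open>v\<close> has finitely many discontinuities on \<open>[t\<^sub>0, t\<^sub>1]\<close> is the library
  notion of piecewise continuous differentiability: apart from a finite set, \<open>v\<close> is differentiable
  with continuous derivative. A time at which the derivative fails to exist counts as a
  discontinuity.
\<close>
definition simple_path_in ::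
  "(real \<Rightarrow> plane) set \<Rightarrow> plane set \<Rightarrow> plane \<Rightarrow> plane \<Rightarrow> bool" where
  "simple_path_in D V a b \<longleftrightarrow>
     (\<exists>v\<in>D. \<exists>t\<^sub>0 t\<^sub>1. t\<^sub>0 < t\<^sub>1 \<and> v t\<^sub>0 = a \<and> v t\<^sub>1 = b \<and>
        v piecewise_C1_differentiable_on {t\<^sub>0..t\<^sub>1} \<and>
        (\<forall>t\<in>{t\<^sub>0<..<t\<^sub>1}. v t \<noteq> a \<and> v t \<noteq> b) \<and>
        v ` {t\<^sub>0..t\<^sub>1} \<subseteq> V)"

definition RS1 :: "(real \<Rightarrow> plane) set \<Rightarrow> plane set \<Rightarrow> bool" where
  "RS1 D V \<longleftrightarrow> (\<forall>a\<in>V. \<forall>b\<in>V. simple_path_in D V a b)"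

definition RS2 :: "(real \<Rightarrow> plane) set \<Rightarrow> plane set \<Rightarrow> bool" where
  "RS2 D V \<longleftrightarrow> (\<exists>w\<in>D. range w \<subseteq> V \<and> \<not> V \<subseteq> closure (range w))"

definition solutions_within :: "(real \<Rightarrow> plane) set \<Rightarrow> plane set \<Rightarrow> (real \<Rightarrow> plane) set" where
  "solutions_within D V = {x\<in>D. \<forall>t. x t \<in> V}"

section \<open>Devaney chaos\<close>

definition periodic :: "(real \<Rightarrow> plane) \<Rightarrow> bool" where
  "periodic x \<longleftrightarrow> (\<exists>p>0. shift p x = x)"

definition topologically_transitive :: "(real \<Rightarrow> plane) set \<Rightarrow> bool" where
  "topologically_transitive R \<longleftrightarrow>
     (\<forall>U W. openin (nu_topology R) U \<longrightarrow> openin (nu_topology R) W \<longrightarrow> U \<noteq> {} \<longrightarrow> W \<noteq> {} \<longrightarrow>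
        (\<exists>t. shift t ` U \<inter> W \<noteq> {}))"

definition dense_periodic_points :: "(real \<Rightarrow> plane) set \<Rightarrow> bool" where
  "dense_periodic_points R \<longleftrightarrow> nu_topology R closure_of {x\<in>R. periodic x} = R"

definition sensitive_dependence :: "(real \<Rightarrow> plane) set \<Rightarrow> bool" where
  "sensitive_dependence R \<longleftrightarrow>
     (\<exists>\<delta>>0. \<forall>x\<in>R. \<forall>\<epsilon>>0. \<exists>z\<in>R. nu x z < \<epsilon> \<and> (\<exists>s. nu (shift s x) (shift s z) > \<delta>))"

text \<open>
  The notion is meant for sets \<open>R\<close> that are shift invariant and closed in the ambient space of
  solutions; these requirements are not part of the predicate.
\<close>
definition devaney_chaos :: "(real \<Rightarrow> plane) set \<Rightarrow> bool" where
  "devaney_chaos R \<longleftrightarrow>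
     topologically_transitive R \<and> dense_periodic_points R \<and> sensitive_dependence R"

section \<open>Omega-chaos\<close>

definition omega_limit :: "(real \<Rightarrow> plane) set \<Rightarrow> (real \<Rightarrow> plane) \<Rightarrow> (real \<Rightarrow> plane) set" where
  "omega_limit D x =
     {y\<in>D. \<exists>\<tau> :: nat \<Rightarrow> real. filterlim \<tau> at_top sequentially \<and>
             limitin (nu_topology D) (\<lambda>n. shift (\<tau> n) x) y sequentially}"

definition omega_scrambled :: "(real \<Rightarrow> plane) set \<Rightarrow> (real \<Rightarrow> plane) set \<Rightarrow> bool" where
  "omega_scrambled D S \<longleftrightarrow>
     S \<subseteq> D \<and> (\<exists>x\<in>S. \<exists>y\<in>S. x \<noteq> y) \<and>
     (\<forall>x\<in>S. \<forall>y\<in>S. x \<noteq> y \<longrightarrow>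
        uncountable (omega_limit D x - omega_limit D y) \<and>
        omega_limit D x \<inter> omega_limit D y \<noteq> {} \<and>
        \<not> omega_limit D x \<subseteq> {z\<in>D. periodic z})"

definition omega_chaotic :: "(real \<Rightarrow> plane) set \<Rightarrow> bool" where
  "omega_chaotic D \<longleftrightarrow> (\<exists>S. uncountable S \<and> omega_scrambled D S)"

section \<open>Topological entropy\<close>

text \<open>The supremum is a maximum, see \<open>nu_window_attained\<close> below.\<close>
definition nu_window :: "real \<Rightarrow> (real \<Rightarrow> plane) \<Rightarrow> (real \<Rightarrow> plane) \<Rightarrow> real" where
  "nu_window s x y = (SUP t\<in>{-s..s}. nu (shift t x) (shift t y))"

definition bowen_ball ::
  "(real \<Rightarrow> plane) set \<Rightarrow> (real \<Rightarrow> plane) \<Rightarrow> real \<Rightarrow> real \<Rightarrow> (real \<Rightarrow> plane) set" where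
  "bowen_ball D x \<epsilon> s = {y\<in>D. nu_window s x y < \<epsilon>}"

definition spanning ::
  "(real \<Rightarrow> plane) set \<Rightarrow> real \<Rightarrow> real \<Rightarrow> (real \<Rightarrow> plane) set \<Rightarrow> bool" where
  "spanning D s \<epsilon> E \<longleftrightarrow> E \<subseteq> D \<and> D \<subseteq> (\<Union>x\<in>E. bowen_ball D x \<epsilon> s)"

text \<open>The value is \<open>\<infinity>\<close> if there is no finite spanning set.\<close>
definition spanning_number :: "(real \<Rightarrow> plane) set \<Rightarrow> real \<Rightarrow> real \<Rightarrow> enat" where
  "spanning_number D \<epsilon> s =
     (INF E \<in> {E. spanning D s \<epsilon> E}. if finite E then enat (card E) else \<infinity>)"

definition log_enat :: "enat \<Rightarrow> ereal" where
  "log_enat n =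
     (case n of enat k \<Rightarrow> (if k = 0 then - \<infinity> else ereal (ln (real k))) | \<infinity> \<Rightarrow> \<infinity>)"

definition entropy_at :: "(real \<Rightarrow> plane) set \<Rightarrow> real \<Rightarrow> ereal" where
  "entropy_at D \<epsilon> = Limsup at_top (\<lambda>s::real. log_enat (spanning_number D \<epsilon> s) / ereal s)"

text \<open>The limit always exists, see \<open>entropy_at_tendsto\<close> below.\<close>
definition topological_entropy :: "(real \<Rightarrow> plane) set \<Rightarrow> ereal" where
  "topological_entropy D = Lim (at_right 0) (entropy_at D)"

lemma nu_shift_le: "nu (shift (t + h) x) (shift (t + h) y) \<le> 2 powr \<bar>h\<bar> * nu (shift t x) (shift t y)"
proof (rule nu_least)
  fix s
  have eq: "nu_at s (shift (t + h) x) (shift (t + h) y) = nu_at (h + s) (shift t x) (shift t y)"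
    by (simp add: nu_at_def shift_def add.assoc)
  have "nu_at (h + s) (shift t x) (shift t y) \<le> 2 powr \<bar>h + s\<bar> * nu (shift t x) (shift t y)"
    using nu_upper[of "h + s" "shift t x" "shift t y"] by (simp add: divide_le_eq mult.commute)
  also have "\<dots> \<le> 2 powr (\<bar>h\<bar> + \<bar>s\<bar>) * nu (shift t x) (shift t y)"
    by (intro mult_right_mono nu_nonneg) simp
  also have "\<dots> = (2 powr \<bar>h\<bar> * nu (shift t x) (shift t y)) * 2 powr \<bar>s\<bar>"
    by (simp add: powr_add)
  finally show "nu_at s (shift (t + h) x) (shift (t + h) y) / 2 powr \<bar>s\<bar>
      \<le> 2 powr \<bar>h\<bar> * nu (shift t x) (shift t y)"
    by (simp add: eq divide_le_eq)
qed

lemma isCont_nu_shift: "isCont (\<lambda>t. nu (shift t x) (shift t y)) t"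
proof -
  let ?g = "\<lambda>t. nu (shift t x) (shift t y)"
  have up: "?g u \<le> 2 powr \<bar>u - t\<bar> * ?g t" for u
    using nu_shift_le[of t "u - t" x y] by simp
  have "?g t / 2 powr \<bar>u - t\<bar> \<le> ?g u" for u
    using nu_shift_le[of u "t - u" x y] by (simp add: divide_le_eq abs_minus_commute mult.commute)
  moreover have "((\<lambda>u. 2 powr \<bar>u - t\<bar> * ?g t) \<longlongrightarrow> 2 powr \<bar>t - t\<bar> * ?g t) (at t)"
    by (intro tendsto_intros) auto
  moreover have "((\<lambda>u. ?g t / 2 powr \<bar>u - t\<bar>) \<longlongrightarrow> ?g t / 2 powr \<bar>t - t\<bar>) (at t)"
    by (intro tendsto_intros) auto
  ultimately show ?thesis
    unfolding isCont_def
    by (intro tendsto_sandwich[of "\<lambda>u. ?g t / 2 powr \<bar>u - t\<bar>" ?g _ "\<lambda>u. 2 powr \<bar>u - t\<bar> * ?g t"])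
       (auto simp: up)
qed

lemma nu_window_attained:
  assumes "s > 0"
  obtains t where "t \<in> {-s..s}" "nu_window s x y = nu (shift t x) (shift t y)"
    "\<And>u. u \<in> {-s..s} \<Longrightarrow> nu (shift u x) (shift u y) \<le> nu (shift t x) (shift t y)"
proof -
  have "continuous_on {-s..s} (\<lambda>t. nu (shift t x) (shift t y))"
    by (intro continuous_at_imp_continuous_on ballI isCont_nu_shift)
  moreover have "{-s..s} \<noteq> {}" using assms by simp
  ultimately obtain t where t: "t \<in> {-s..s}"
    "\<forall>u\<in>{-s..s}. nu (shift u x) (shift u y) \<le> nu (shift t x) (shift t y)"
    using continuous_attains_sup[OF compact_Icc] by blast
  moreover have "nu_window s x y = nu (shift t x) (shift t y)"
    unfolding nu_window_def by (rule cSup_eq_maximum) (use t in auto)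
  ultimately show ?thesis using that[of t] by blast
qed

lemma mono_log_enat: "m \<le> n \<Longrightarrow> log_enat m \<le> log_enat n"
  by (cases m; cases n) (auto simp: log_enat_def)

lemma spanning_number_antimono:
  assumes "\<epsilon> \<le> \<epsilon>'"
  shows "spanning_number D \<epsilon>' s \<le> spanning_number D \<epsilon> s"
proof -
  have "bowen_ball D x \<epsilon> s \<subseteq> bowen_ball D x \<epsilon>' s" for x
    using assms by (auto simp: bowen_ball_def)
  then have "{E. spanning D s \<epsilon> E} \<subseteq> {E. spanning D s \<epsilon>' E}"
    unfolding spanning_def by blast
  then show ?thesis
    unfolding spanning_number_def by (rule INF_superset_mono) simp
qed

lemma entropy_at_antimono:
  assumes "\<epsilon> \<le> \<epsilon>'"
  shows "entropy_at D \<epsilon>' \<le> entropy_at D \<epsilon>"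
  unfolding entropy_at_def
proof (rule Limsup_mono, rule eventually_mono[OF eventually_gt_at_top[of 0]])
  fix s :: real assume "0 < s"
  then show "log_enat (spanning_number D \<epsilon>' s) / ereal s \<le> log_enat (spanning_number D \<epsilon> s) / ereal s"
    by (intro ereal_divide_right_mono mono_log_enat spanning_number_antimono assms) simp
qed

lemma entropy_at_tendsto: "(entropy_at D \<longlongrightarrow> (SUP \<epsilon>\<in>{0<..}. entropy_at D \<epsilon>)) (at_right 0)"
proof (rule order_tendstoI)
  fix a assume "a < (SUP \<epsilon>\<in>{0<..}. entropy_at D \<epsilon>)"
  then obtain e where e: "e > 0" "a < entropy_at D e" by (auto simp: less_SUP_iff)
  have "a < entropy_at D \<epsilon>" if "\<epsilon> < e" for \<epsilon>
    using e(2) entropy_at_antimono[of \<epsilon> e D] that by (meson less_imp_le less_le_trans)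
  with e(1) show "eventually (\<lambda>\<epsilon>. a < entropy_at D \<epsilon>) (at_right 0)"
    unfolding eventually_at_right_field by blast
next
  fix a assume a: "(SUP \<epsilon>\<in>{0<..}. entropy_at D \<epsilon>) < a"
  have "entropy_at D \<epsilon> < a" if "\<epsilon> > 0" for \<epsilon>
    using that by (intro le_less_trans[OF SUP_upper a]) simp
  then show "eventually (\<lambda>\<epsilon>. entropy_at D \<epsilon> < a) (at_right 0)"
    unfolding eventually_at_right_field using zero_less_one by blast
qed

lemma topological_entropy_eq_SUP: "topological_entropy D = (SUP \<epsilon>\<in>{0<..}. entropy_at D \<epsilon>)"
  unfolding topological_entropy_def by (rule tendsto_Lim[OF _ entropy_at_tendsto]) simp

end

theory Submission
  imports Defs
begin

text \<open>
  One example serves all three parts. A point runs around the unit circle with unit speed, and the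
  second field is identically zero, so that a point of the circle may also rest. The set \<open>D\<close> contains
  the motion around the circle with every phase, together with a single solution that rests at
  \<open>(1, 0)\<close>; the set \<open>V\<close> is the circle. One turn or less of the circular motion is a simple path
  between any two points of the circle, equal or not, which gives (RS1). The rest solution
  occupies only one point of the circle, which gives (RS2).

  \<^item> Every solution of \<open>D\<close> lies in \<open>V\<close>. The rest solution is an isolated point of \<open>D\<close>, because every
    circular motion reaches the opposite point \<open>(-1, 0)\<close> within the time of one turn. So there is
    no sensitive dependence on initial conditions at the rest solution (lemma \<open>rest_isolated\<close>).
  \<^item> Every solution in \<open>D\<close> is periodic, whereas an omega-scrambled set needs limit points that are not
    (lemma \<open>not_omega_chaotic_if_all_periodic\<close>).
  \<^item> Circular motions with phases \<open>a\<close> and \<open>b\<close> remain within distance \<open>\<bar>a - b\<bar>\<close> forever. A finite net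
    of phases therefore spans \<open>D\<close> for all time windows at once, the spanning numbers do not grow,
    and the entropy is not positive (lemma \<open>entropy_nonpos_if_uniformly_spanned\<close>).
\<close>

section \<open>General facts on solution sets\<close>

lemma lipschitz_imp_absolutely_continuous_on:
  fixes g :: "real \<Rightarrow> 'a::real_normed_vector"
  assumes lip: "\<And>s t. norm (g s - g t) \<le> L * \<bar>s - t\<bar>"
  shows "absolutely_continuous_on S g"
  unfolding absolutely_continuous_on_def
proof (intro allI impI)
  fix \<epsilon> :: real assume "\<epsilon> > 0"
  have "0 \<le> L" using order_trans[OF norm_ge_zero lip[of 1 0]] by simp
  \<comment> \<open>The denominator is \<open>L + 1\<close> since \<open>L\<close> may be zero.\<close>
  show "\<exists>\<delta>>0. \<forall>d t. d division_of t \<longrightarrow> t \<subseteq> S \<longrightarrow> (\<Sum>k\<in>d. Sup k - Inf k) < \<delta> \<longrightarrow>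
        (\<Sum>k\<in>d. norm (g (Sup k) - g (Inf k))) < \<epsilon>"
  proof (intro exI[of _ "\<epsilon> / (L + 1)"] conjI allI impI)
    show "\<epsilon> / (L + 1) > 0" using \<open>\<epsilon> > 0\<close> \<open>0 \<le> L\<close> by simp
    fix d t assume d: "d division_of t" and small: "(\<Sum>k\<in>d. Sup k - Inf k) < \<epsilon> / (L + 1)"
    have ordered: "Inf k \<le> Sup k" if k: "k \<in> d" for k :: "real set"
    proof -
      obtain a b where "k = cbox a b" "k \<noteq> {}" using division_ofD(3,4)[OF d k] by blast
      then show ?thesis by auto
    qed
    have "(\<Sum>k\<in>d. norm (g (Sup k) - g (Inf k))) \<le> (\<Sum>k\<in>d. (L + 1) * (Sup k - Inf k))"
    proof (rule sum_mono)
      fix k assume k: "k \<in> d"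
      have "norm (g (Sup k) - g (Inf k)) \<le> L * (Sup k - Inf k)"
        using lip[of "Sup k" "Inf k"] ordered[OF k] by simp
      also have "\<dots> \<le> (L + 1) * (Sup k - Inf k)"
        using ordered[OF k] by (intro mult_right_mono) auto
      finally show "norm (g (Sup k) - g (Inf k)) \<le> (L + 1) * (Sup k - Inf k)" .
    qed
    also have "\<dots> = (L + 1) * (\<Sum>k\<in>d. Sup k - Inf k)" by (simp add: sum_distrib_left)
    also have "\<dots> < \<epsilon>" using small \<open>0 \<le> L\<close> by (simp add: field_simps)
    finally show "(\<Sum>k\<in>d. norm (g (Sup k) - g (Inf k))) < \<epsilon>" .
  qed
qed

lemma bounded_linear_imp_C1_field:
  assumes "bounded_linear f"
  shows "C1_field f"
proof -
  have "(f has_derivative blinfun_apply (Blinfun f)) (at x)" for x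
    using bounded_linear_imp_has_derivative[OF assms] by (simp add: bounded_linear_Blinfun_apply[OF assms])
  then show ?thesis
    unfolding C1_field_def by (intro exI[of _ "\<lambda>_. Blinfun f"]) simp
qed

lemma not_omega_chaotic_if_all_periodic:
  assumes "\<And>x. x \<in> D \<Longrightarrow> periodic x"
  shows "\<not> omega_chaotic D"
proof
  assume "omega_chaotic D"
  then obtain x where "\<not> omega_limit D x \<subseteq> {z\<in>D. periodic z}"
    unfolding omega_chaotic_def omega_scrambled_def by meson
  moreover have "omega_limit D x \<subseteq> D" by (auto simp: omega_limit_def)
  ultimately show False using assms by blast
qed

text \<open>Close to an isolated solution there is only the solution itself, and it never leaves itself.\<close>
lemma not_sensitive_if_isolated:
  assumes "r \<in> R" and "\<epsilon> > 0" and "\<And>z. z \<in> R \<Longrightarrow> nu r z < \<epsilon> \<Longrightarrow> z = r"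
  shows "\<not> sensitive_dependence R"
proof
  assume "sensitive_dependence R"
  then obtain \<delta> z s where "\<delta> > 0" "z \<in> R" "nu r z < \<epsilon>" "nu (shift s r) (shift s z) > \<delta>"
    unfolding sensitive_dependence_def using assms(1,2) by meson
  moreover have "nu (shift s r) (shift s r) \<le> 0"
    by (rule nu_least) (simp add: nu_at_def)
  moreover have "z = r" using assms(3) \<open>z \<in> R\<close> \<open>nu r z < \<epsilon>\<close> .
  ultimately show False by simp
qed

lemma nu_le_if_dist_le:
  assumes "\<And>t. dist (x t) (y t) \<le> e"
  shows "nu x y \<le> e"
proof (rule nu_least)
  fix t
  have "0 \<le> e" using order_trans[OF zero_le_dist assms] .
  have "nu_at t x y / 2 powr \<bar>t\<bar> \<le> e / 2 powr \<bar>t\<bar>"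
    using assms[of t] by (intro divide_right_mono) (auto simp: nu_at_def)
  also have "\<dots> \<le> e"
    using \<open>0 \<le> e\<close> ge_one_powr_ge_zero[of 2 "\<bar>t\<bar>"] by (simp add: divide_le_eq mult_left_le mult_le_cancel_left1)
  finally show "nu_at t x y / 2 powr \<bar>t\<bar> \<le> e" .
qed

lemma nu_window_le_if_dist_le:
  assumes "0 < s" and "\<And>t. dist (x t) (y t) \<le> e"
  shows "nu_window s x y \<le> e"
  unfolding nu_window_def
  using assms by (intro cSUP_least nu_le_if_dist_le) (auto simp: shift_def)

text \<open>
  If one finite set works for every time window, then its cardinality \<open>K\<close> bounds all spanning
  numbers, and \<open>ln K / s\<close> tends to zero.
\<close>
lemma entropy_nonpos_if_uniformly_spanned:
  assumes span: "\<And>\<epsilon>. \<epsilon> > 0 \<Longrightarrow> \<exists>E. finite E \<and> (\<forall>s>0. spanning D s \<epsilon> E)"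
  shows "topological_entropy D \<le> 0"
  unfolding topological_entropy_eq_SUP
proof (rule SUP_least)
  fix \<epsilon> :: real assume "\<epsilon> \<in> {0<..}"
  then obtain E where E: "finite E" "\<And>s. s > 0 \<Longrightarrow> spanning D s \<epsilon> E" using span[of \<epsilon>] by auto
  have bound: "log_enat (spanning_number D \<epsilon> s) / ereal s \<le> ereal (ln (card E) / s)" if "s > 0" for s
  proof -
    have "spanning_number D \<epsilon> s \<le> enat (card E)"
      unfolding spanning_number_def using E that by (intro INF_lower2[of E]) auto
    then have "log_enat (spanning_number D \<epsilon> s) \<le> log_enat (enat (card E))"
      by (rule mono_log_enat)
    \<comment> \<open>If \<open>E\<close> is empty, then the left side is \<open>- \<infinity>\<close> and \<open>ln 0 = 0\<close>.\<close>
    also have "\<dots> \<le> ereal (ln (card E))" by (simp add: log_enat_def)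
    finally have "log_enat (spanning_number D \<epsilon> s) / ereal s \<le> ereal (ln (card E)) / ereal s"
      using that by (intro ereal_divide_right_mono) auto
    then show ?thesis using that by simp
  qed
  have "((\<lambda>s. ln (card E) / s) \<longlongrightarrow> 0) at_top"
    by (intro tendsto_divide_0[OF tendsto_const] filterlim_at_top_imp_at_infinity filterlim_ident)
  then have lim: "((\<lambda>s. ereal (ln (card E) / s)) \<longlongrightarrow> 0) at_top"
    by (simp add: zero_ereal_def)
  have "entropy_at D \<epsilon> \<le> Limsup at_top (\<lambda>s. ereal (ln (card E) / s))"
    unfolding entropy_at_def
    by (intro Limsup_mono eventually_mono[OF eventually_gt_at_top[of 0]] bound)
  also have "\<dots> = 0" using lim by (intro lim_imp_Limsup) auto
  finally show "entropy_at D \<epsilon> \<le> 0" .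
qed

section \<open>Motion around the unit circle\<close>

definition rotation_field :: "plane \<Rightarrow> plane" where
  "rotation_field x = vector [- x $ 2, x $ 1]"

definition circ :: "real \<Rightarrow> plane" where
  "circ t = vector [cos t, sin t]"

lemma bounded_linear_rotation_field: "bounded_linear rotation_field"
  unfolding linear_conv_bounded_linear[symmetric]
  by (rule linearI) (simp_all add: rotation_field_def vec_eq_iff forall_2)

lemma circ_eq_iff: "circ s = circ t \<longleftrightarrow> (\<exists>n::int. s = t + 2 * pi * n)"
  using sin_cos_eq_iff[of s t] by (auto simp: circ_def vec_eq_iff forall_2)

lemma circ_neq:
  assumes "s < t" "t < s + 2 * pi"
  shows "circ s \<noteq> circ t"
proof
  assume "circ s = circ t"
  then obtain n :: int where n: "s = t + 2 * pi * n" unfolding circ_eq_iff by blast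
  with assms have "2 * pi * real_of_int n < 2 * pi * 0" "2 * pi * (-1) < 2 * pi * real_of_int n"
    by linarith+
  then have "real_of_int n < 0" "-1 < real_of_int n"
    by (simp_all only: mult_less_cancel_left_pos[of "2 * pi"] pi_gt_zero zero_less_mult_iff zero_less_numeral simp_thms)
  then have "n < 0" "-1 < n" by simp_all
  then show False by simp
qed

lemma circ_eq_in_next_turn:
  obtains t where "s < t" "t \<le> s + 2 * pi" "circ t = circ u"
proof -
  \<comment> \<open>The number of whole turns to remove. The interval is open at \<open>s\<close> and closed at \<open>s + 2 * pi\<close>, hence
    the ceiling minus one in place of the floor.\<close>
  define n where "n = \<lceil>(u - s) / (2 * pi)\<rceil> - 1"
  define t where "t = u - 2 * pi * n"
  have "of_int n < (u - s) / (2 * pi)" "(u - s) / (2 * pi) \<le> of_int n + 1"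
    unfolding n_def by linarith+
  then have "s < t" "t \<le> s + 2 * pi"
    unfolding t_def using pi_gt_zero by (simp_all add: field_simps)
  moreover have "circ t = circ u"
    unfolding circ_eq_iff t_def by (intro exI[of _ "- n"]) simp
  ultimately show ?thesis using that by blast
qed

lemma circ_has_vector_derivative: "(circ has_vector_derivative rotation_field (circ t)) (at t)"
proof -
  have circ: "circ = (\<lambda>t. cos t *\<^sub>R axis 1 1 + sin t *\<^sub>R axis 2 1)"
    by (simp add: fun_eq_iff circ_def vec_eq_iff forall_2 axis_def)
  have "(circ has_vector_derivative (- sin t *\<^sub>R axis 1 1 + cos t *\<^sub>R axis 2 1)) (at t)"
    unfolding circ by (auto intro!: derivative_eq_intros)
  moreover have "- sin t *\<^sub>R axis 1 1 + cos t *\<^sub>R axis 2 1 = rotation_field (circ t)"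
    by (simp add: rotation_field_def circ_def vec_eq_iff forall_2 axis_def)
  ultimately show ?thesis by simp
qed

lemma dist_circ_le: "dist (circ s) (circ t) \<le> \<bar>s - t\<bar>"
proof -
  have unit: "norm (rotation_field (circ u)) = 1" for u
    by (simp add: rotation_field_def circ_def norm_eq_sqrt_inner inner_vec_def sum_2
        flip: power2_eq_square)
  have "norm (circ s - circ t) \<le> 1 * norm (s - t)"
  proof (rule differentiable_bound[OF convex_UNIV])
    show "(circ has_derivative (\<lambda>h. h *\<^sub>R rotation_field (circ u))) (at u)" for u
      using circ_has_vector_derivative[of u] by (simp add: has_vector_derivative_def)
    show "onorm (\<lambda>h. h *\<^sub>R rotation_field (circ u)) \<le> 1" for u
      by (rule onorm_le) (simp add: unit)
  qed auto
  then show ?thesis by (simp add: dist_norm)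
qed

lemma circ_C1_differentiable_on: "circ C1_differentiable_on S"
  unfolding C1_differentiable_on_def
proof (intro exI[of _ "\<lambda>t. rotation_field (circ t)"] conjI ballI circ_has_vector_derivative)
  have "continuous_on S circ"
    by (intro continuous_at_imp_continuous_on ballI
        has_vector_derivative_continuous[OF circ_has_vector_derivative])
  then show "continuous_on S (\<lambda>t. rotation_field (circ t))"
    by (rule bounded_linear.continuous_on[OF bounded_linear_rotation_field])
qed

section \<open>Circular motions together with one rest solution\<close>

definition circ_rest :: "real \<Rightarrow> plane" where
  "circ_rest = (\<lambda>_. circ 0)"

definition circ_solutions :: "(real \<Rightarrow> plane) set" where
  "circ_solutions = insert circ_rest (range (\<lambda>a. shift a circ))"

lemma circ_solutionsE:
  assumes "x \<in> circ_solutions"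
  obtains "x = circ_rest" | a where "x = shift a circ"
  using assms unfolding circ_solutions_def by blast

lemma circ_in_circ_solutions: "circ \<in> circ_solutions"
proof -
  have "circ = shift 0 circ" by (simp add: shift_def)
  then show ?thesis unfolding circ_solutions_def by blast
qed

lemma circ_solutions_is_solution:
  assumes "x \<in> circ_solutions"
  shows "is_solution rotation_field (\<lambda>_. 0) x"
  using assms
proof (cases rule: circ_solutionsE)
  case 1
  then show ?thesis
    by (auto simp: is_solution_def circ_rest_def
        intro: lipschitz_imp_absolutely_continuous_on[of _ 0])
next
  case (2 a)
  have "norm (x s - x t) \<le> 1 * \<bar>s - t\<bar>" for s t
    using dist_circ_le[of "a + s" "a + t"] by (simp add: 2 shift_def dist_norm)
  moreover have "(x has_vector_derivative rotation_field (x t)) (at t)" for t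
  proof -
    have "((\<lambda>s. a + s) has_vector_derivative 1) (at t)" by (auto intro!: derivative_eq_intros)
    from vector_diff_chain_at[OF this circ_has_vector_derivative]
    show ?thesis by (simp add: 2 shift_def o_def)
  qed
  ultimately show ?thesis
    unfolding is_solution_def by (auto intro: lipschitz_imp_absolutely_continuous_on[of _ 1])
qed

lemma circ_solutions_periodic:
  assumes "x \<in> circ_solutions"
  shows "periodic x"
  using assms
proof (cases rule: circ_solutionsE)
  case 1
  then show ?thesis by (auto simp: periodic_def shift_def circ_rest_def intro: exI[of _ 1])
next
  case (2 a)
  have "circ (a + (2 * pi + s)) = circ (a + s)" for s
    unfolding circ_eq_iff by (intro exI[of _ 1]) simp
  then show ?thesis
    unfolding periodic_def by (intro exI[of _ "2 * pi"]) (simp add: 2 shift_def)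
qed

lemma shift_invariant_circ_solutions: "shift_invariant circ_solutions"
proof -
  have "shift t circ_rest = circ_rest" for t by (simp add: shift_def circ_rest_def)
  moreover have "shift t (shift a circ) = shift (a + t) circ" for t a
    by (simp add: shift_def add.assoc)
  ultimately show ?thesis
    unfolding shift_invariant_def circ_solutions_def by auto
qed

lemma solutions_within_circ: "solutions_within circ_solutions (range circ) = circ_solutions"
proof -
  have "x t \<in> range circ" if "x \<in> circ_solutions" for x t
    using that by (cases rule: circ_solutionsE) (simp_all add: circ_rest_def shift_def)
  then show ?thesis by (auto simp: solutions_within_def)
qed

text \<open>
  The path from \<open>circ s\<close> runs from time \<open>s\<close> to the first later time at which the target is reached.
  This is at most one turn, and exactly one turn if the path is to return to \<open>circ s\<close>, so that
  neither end point is met in between.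
\<close>
lemma RS1_circ_solutions: "RS1 circ_solutions (range circ)"
  unfolding RS1_def simple_path_in_def
proof (intro ballI)
  fix a b assume "a \<in> range circ" "b \<in> range circ"
  then obtain s u where a: "a = circ s" and u: "b = circ u" by blast
  obtain t where t: "s < t" "t \<le> s + 2 * pi" and b: "b = circ t"
    using circ_eq_in_next_turn[of s u] u by metis
  have "circ r \<noteq> circ s" "circ r \<noteq> circ t" if "s < r" "r < t" for r
    using circ_neq[of s r] circ_neq[of r t] that t by auto
  then show "\<exists>v\<in>circ_solutions. \<exists>t\<^sub>0 t\<^sub>1. t\<^sub>0 < t\<^sub>1 \<and> v t\<^sub>0 = a \<and> v t\<^sub>1 = b \<and>
        v piecewise_C1_differentiable_on {t\<^sub>0..t\<^sub>1} \<and>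
        (\<forall>t\<in>{t\<^sub>0<..<t\<^sub>1}. v t \<noteq> a \<and> v t \<noteq> b) \<and> v ` {t\<^sub>0..t\<^sub>1} \<subseteq> range circ"
    using t(1) a b
    by (intro bexI[of _ circ] exI[of _ s] exI[of _ t] circ_in_circ_solutions)
       (auto intro: C1_differentiable_imp_piecewise circ_C1_differentiable_on)
qed

lemma RS2_circ_solutions: "RS2 circ_solutions (range circ)"
proof -
  have "circ pi \<notin> {circ 0}" using circ_neq[of 0 pi] by simp
  then have "\<not> range circ \<subseteq> {circ 0}" by blast
  then have "\<not> range circ \<subseteq> closure (range circ_rest)" by (simp add: circ_rest_def)
  then show ?thesis
    unfolding RS2_def by (intro bexI[of _ circ_rest]) (auto simp: circ_solutions_def circ_rest_def)
qed

text \<open>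
  Within the time \<open>2 * pi\<close> of one turn, a circular motion is at distance \<open>2\<close> from the rest point. At
  that time the truncated distance is \<open>1\<close>, and it is weighted with at least \<open>2 powr (- (2 * pi))\<close>.
\<close>
lemma rest_isolated:
  assumes "z \<in> circ_solutions" and close: "nu circ_rest z < 2 powr (- (2 * pi))"
  shows "z = circ_rest"
  using assms(1)
proof (cases rule: circ_solutionsE)
  case (2 a)
  obtain u where u: "a < u" "u \<le> a + 2 * pi" "circ u = circ pi" by (rule circ_eq_in_next_turn)
  have "dist (circ 0) (circ pi) = 2"
    by (simp add: circ_def dist_vec_def L2_set_def sum_2 dist_real_def)
  then have "nu_at (u - a) circ_rest z = 1"
    using u(3) by (simp add: nu_at_def circ_rest_def 2 shift_def)
  then have "1 / 2 powr \<bar>u - a\<bar> \<le> nu circ_rest z"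
    using nu_upper[of "u - a" circ_rest z] by simp
  moreover have "2 powr (- (2 * pi)) \<le> 1 / 2 powr \<bar>u - a\<bar>"
    using u by (simp add: powr_minus_divide[symmetric])
  ultimately show ?thesis using close by linarith
qed simp

lemma not_devaney_chaos_circ_solutions: "\<not> devaney_chaos circ_solutions"
proof -
  have "circ_rest \<in> circ_solutions" by (simp add: circ_solutions_def)
  then have "\<not> sensitive_dependence circ_solutions"
    by (rule not_sensitive_if_isolated[where \<epsilon> = "2 powr (- (2 * pi))"]) (simp_all add: rest_isolated)
  then show ?thesis by (simp add: devaney_chaos_def)
qed

text \<open>
  It is enough to take phases from a finite net of the compact interval \<open>{0..2 * pi}\<close>, because the
  motion is periodic and motions with different phases never drift apart.
\<close>
lemma circ_solutions_uniformly_spanned: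
  assumes "\<epsilon> > 0"
  shows "\<exists>E. finite E \<and> (\<forall>s>0. spanning circ_solutions s \<epsilon> E)"
proof -
  have "seq_compact {0..2 * pi}" by (simp add: compact_imp_seq_compact)
  then obtain A where A: "finite A" "{0..2 * pi} \<subseteq> (\<Union>a\<in>A. ball a \<epsilon>)"
    using seq_compact_imp_totally_bounded assms by metis
  define E where "E = insert circ_rest ((\<lambda>a. shift a circ) ` A)"
  have "\<exists>x\<in>E. nu_window s x y < \<epsilon>" if "y \<in> circ_solutions" "s > 0" for y s
    using that(1)
  proof (cases rule: circ_solutionsE)
    case 1
    have "nu_window s circ_rest circ_rest \<le> 0" by (rule nu_window_le_if_dist_le[OF that(2)]) simp
    then show ?thesis using assms by (auto simp: E_def 1)
  next
    case (2 b)
    obtain c where c: "0 < c" "c \<le> 0 + 2 * pi" "circ c = circ b" by (rule circ_eq_in_next_turn)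
    then have "c \<in> (\<Union>a\<in>A. ball a \<epsilon>)" by (intro subsetD[OF A(2)]) simp
    then obtain a where a: "a \<in> A" "\<bar>a - c\<bar> < \<epsilon>" by (auto simp: dist_real_def)
    obtain n :: int where "c = b + 2 * pi * n" using c(3) unfolding circ_eq_iff by blast
    then have "circ (b + t) = circ (c + t)" for t
      unfolding circ_eq_iff by (intro exI[of _ "- n"]) simp
    then have "y = shift c circ" by (simp add: 2 shift_def)
    moreover have "nu_window s (shift a circ) (shift c circ) \<le> \<bar>a - c\<bar>"
    proof (rule nu_window_le_if_dist_le[OF that(2)])
      show "dist (shift a circ t) (shift c circ t) \<le> \<bar>a - c\<bar>" for t
        using dist_circ_le[of "a + t" "c + t"] by (simp add: shift_def)
    qed
    ultimately have "nu_window s (shift a circ) y < \<epsilon>" using a(2) by simp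
    then show ?thesis using a(1) by (auto simp: E_def)
  qed
  moreover have "E \<subseteq> circ_solutions" by (auto simp: E_def circ_solutions_def)
  ultimately have "spanning circ_solutions s \<epsilon> E" if "s > 0" for s
    using that unfolding spanning_def bowen_ball_def by blast
  moreover have "finite E" using A(1) by (simp add: E_def)
  ultimately show ?thesis by blast
qed

theorem theorem2p1:
  shows
    "(\<exists>(f\<^sub>1 :: real^2 \<Rightarrow> real^2) (f\<^sub>2 :: real^2 \<Rightarrow> real^2) (D :: (real \<Rightarrow> real^2) set) (V :: (real^2) set).
        C1_field f\<^sub>1 \<and> C1_field f\<^sub>2 \<and>
        (\<forall>x\<in>D. is_solution f\<^sub>1 f\<^sub>2 x) \<and> shift_invariant D \<and> V \<noteq> {} \<and>
        RS1 D V \<and> RS2 D V \<and>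
        closedin (nu_topology D) (solutions_within D V) \<and>
        \<not> devaney_chaos (solutions_within D V)) \<and>
     (\<exists>(f\<^sub>1 :: real^2 \<Rightarrow> real^2) (f\<^sub>2 :: real^2 \<Rightarrow> real^2) (D :: (real \<Rightarrow> real^2) set) (V :: (real^2) set).
        C1_field f\<^sub>1 \<and> C1_field f\<^sub>2 \<and>
        (\<forall>x\<in>D. is_solution f\<^sub>1 f\<^sub>2 x) \<and> shift_invariant D \<and> V \<noteq> {} \<and>
        RS1 D V \<and>
        \<not> omega_chaotic D) \<and>
     (\<exists>(f\<^sub>1 :: real^2 \<Rightarrow> real^2) (f\<^sub>2 :: real^2 \<Rightarrow> real^2) (D :: (real \<Rightarrow> real^2) set) (V :: (real^2) set).
        C1_field f\<^sub>1 \<and> C1_field f\<^sub>2 \<and>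
        (\<forall>x\<in>D. is_solution f\<^sub>1 f\<^sub>2 x) \<and> shift_invariant D \<and> V \<noteq> {} \<and>
        RS1 D V \<and>
        topological_entropy D \<noteq> \<infinity>)"
proof -
  have C1: "C1_field rotation_field" "C1_field (\<lambda>_. 0)"
    by (simp_all add: bounded_linear_imp_C1_field bounded_linear_rotation_field)
  have sols: "\<forall>x\<in>circ_solutions. is_solution rotation_field (\<lambda>_. 0) x"
    using circ_solutions_is_solution by blast
  have closed: "closedin (nu_topology circ_solutions) circ_solutions"
    using closedin_topspace[of "nu_topology circ_solutions"]
    by (simp add: nu_topology_def Metric_space.topspace_mtopology[OF Metric_space_nu])
  have V: "range circ \<noteq> {}" by simp
  note common = C1 sols shift_invariant_circ_solutions V RS1_circ_solutions
  have omega: "\<not> omega_chaotic circ_solutions"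
    by (rule not_omega_chaotic_if_all_periodic[OF circ_solutions_periodic])
  have entropy: "topological_entropy circ_solutions \<noteq> \<infinity>"
    using entropy_nonpos_if_uniformly_spanned[OF circ_solutions_uniformly_spanned] by auto
  show ?thesis
    by (intro conjI;
        rule exI[of _ rotation_field], rule exI[of _ "\<lambda>_. 0"],
        rule exI[of _ circ_solutions], rule exI[of _ "range circ"], (unfold solutions_within_circ)?;
        intro conjI common RS2_circ_solutions closed not_devaney_chaos_circ_solutions omega entropy)
qed

end
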